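(* Let $G \cong C_{n_1} \oplus C_{n_2} \oplus \cdots \oplus C_{n_r}$ be a finite abelian group with $n_1 \mid n_2 \mid \cdots \mid n_r$. Consider the statements: (i) Every sequence $S$ over $G$ such that $0$ is not a term of $S$ and $N_0(S) = 2^{|S|-D(G)+1}$ contains exactly $|S|-D(G)+1$ minimal zero-sum subsequences, all of which are pairwise disjoint. (ii) There is a natural number $t = t(G)$ such that $|S| \le t$ for every sequence $S$ over $G$ such that $0$ is not a term of $S$ and $N_0(S) = 2^{|S|-D(G)+1}$. (iii) For every subgroup $H$ of $G$ isomorphic to $C_2$, $D(G) \ge D(G/H) + 2$. (iv) For every sequence $S$ over $G$ with $|S|\ge D(G)-1$, $E(S)$ contains no non-trivial subgroup of $G$. Then (i) implies (ii), and (ii), (iii), (iv) are equivalent.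
   Context: $C_n$ denotes the cyclic group of order $n$. A sequence over $G$ is a finite unordered list $S = g_1 \cdots g_m$ of elements of $G$ with repetition allowed; $|S| = m$; subsequences are sub-multisets. For $g \in G$, $N_g(S) = |\{I \subseteq [1,m] : \sum_{i\in I} g_i = g\}|$ (empty index set included). $D(G)$ is the smallest positive integer $\ell$ such that every sequence over $G$ of length at least $\ell$ has a nonempty subsequence with sum $0$. For $|S|\ge D(G)-1$, $E(S) = \{g\in G : N_g(S) = 2^{|S|-D(G)+1}\}$. A minimal zero-sum sequence is a nonempty sequence with sum $0$ none of whose nonempty proper subsequences has sum $0$. Two subsequences are disjoint if their greatest common divisor (longest sequence dividing both) is empty. *)

theory Defs
  imports Complex_Main "HOL-Library.Multiset" "HOL-Combinatorics.List_Permutation"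
    "HOL-Algebra.Algebra"
begin

text \<open>
  Abelian groups are written multiplicatively, as in HOL-Algebra: the neutral element \<open>\<one>\<close>
  plays the role of 0, and sums are products in the group. Sequences over \<open>G\<close> are finite
  multisets of elements of \<open>carrier G\<close>, and subsequences are sub-multisets.
\<close>

definition seq_over :: "('a, 'b) monoid_scheme \<Rightarrow> 'a multiset \<Rightarrow> bool" where
  "seq_over G S \<longleftrightarrow> set_mset S \<subseteq> carrier G"

definition seq_sum :: "('a, 'b) monoid_scheme \<Rightarrow> 'a multiset \<Rightarrow> 'a" where
  "seq_sum G S = finprod G (\<lambda>x. x [^]\<^bsub>G\<^esub> count S x) (set_mset S)"

text \<open>
  \<open>num_subsums G g S\<close> is \<open>N\<^sub>g(S)\<close>. It counts index sets, so repeated terms are distinguished;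
  the indices refer to an arbitrary enumeration of \<open>S\<close>, on which the number does not depend
  (lemma \<open>num_subsums_mset\<close>).
\<close>

definition num_subsums_list :: "('a, 'b) monoid_scheme \<Rightarrow> 'a \<Rightarrow> 'a list \<Rightarrow> nat" where
  "num_subsums_list G g xs =
     card {I. I \<subseteq> {..<length xs} \<and> finprod G (\<lambda>i. xs ! i) I = g}"

definition num_subsums :: "('a, 'b) monoid_scheme \<Rightarrow> 'a \<Rightarrow> 'a multiset \<Rightarrow> nat" where
  "num_subsums G g S = num_subsums_list G g (SOME xs. mset xs = S)"

definition davenport :: "('a, 'b) monoid_scheme \<Rightarrow> nat" where
  "davenport G = (LEAST l. 0 < l \<and>
     (\<forall>S. seq_over G S \<and> l \<le> size S \<longrightarrow>
        (\<exists>T. T \<subseteq># S \<and> T \<noteq> {#} \<and> seq_sum G T = \<one>\<^bsub>G\<^esub>)))"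

definition minimal_zero_sum :: "('a, 'b) monoid_scheme \<Rightarrow> 'a multiset \<Rightarrow> bool" where
  "minimal_zero_sum G T \<longleftrightarrow> seq_over G T \<and> T \<noteq> {#} \<and> seq_sum G T = \<one>\<^bsub>G\<^esub> \<and>
     (\<forall>U. U \<subset># T \<and> U \<noteq> {#} \<longrightarrow> seq_sum G U \<noteq> \<one>\<^bsub>G\<^esub>)"

text \<open>
  The exponent \<open>|S| - D(G) + 1\<close> is an integer which is negative if \<open>|S| < D(G) - 1\<close>. In that
  case the equation below is false, whereas truncated subtraction would make it hold for short
  sequences without nonempty zero-sum subsequences.
\<close>

definition attains_bound :: "('a, 'b) monoid_scheme \<Rightarrow> 'a \<Rightarrow> 'a multiset \<Rightarrow> bool" where
  "attains_bound G g S \<longleftrightarrow>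
     real (num_subsums G g S) = 2 powi (int (size S) - int (davenport G) + 1)"

definition extremal_set :: "('a, 'b) monoid_scheme \<Rightarrow> 'a multiset \<Rightarrow> 'a set" where
  "extremal_set G S = {g \<in> carrier G. attains_bound G g S}"

definition extremal_seqs_disjoint :: "('a, 'b) monoid_scheme \<Rightarrow> bool" where
  "extremal_seqs_disjoint G \<longleftrightarrow>
     (\<forall>S. seq_over G S \<and> \<one>\<^bsub>G\<^esub> \<notin># S \<and> attains_bound G \<one>\<^bsub>G\<^esub> S \<longrightarrow>
        int (card {T. T \<subseteq># S \<and> minimal_zero_sum G T}) = int (size S) - int (davenport G) + 1 \<and>
        (\<forall>T U. T \<subseteq># S \<and> minimal_zero_sum G T \<and> U \<subseteq># S \<and> minimal_zero_sum G U \<and> T \<noteq> U \<longrightarrow>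
           T \<inter># U = {#}))"

definition extremal_seqs_bounded :: "('a, 'b) monoid_scheme \<Rightarrow> bool" where
  "extremal_seqs_bounded G \<longleftrightarrow>
     (\<exists>t::nat. \<forall>S. seq_over G S \<and> \<one>\<^bsub>G\<^esub> \<notin># S \<and> attains_bound G \<one>\<^bsub>G\<^esub> S \<longrightarrow> size S \<le> t)"

definition davenport_quotient_gap :: "('a, 'b) monoid_scheme \<Rightarrow> bool" where
  "davenport_quotient_gap G \<longleftrightarrow>
     (\<forall>H. subgroup H G \<and> G\<lparr>carrier := H\<rparr> \<cong> integer_mod_group 2 \<longrightarrow>
        davenport G \<ge> davenport (G Mod H) + 2)"

definition extremal_sets_no_subgroup :: "('a, 'b) monoid_scheme \<Rightarrow> bool" where
  "extremal_sets_no_subgroup G \<longleftrightarrow>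
     (\<forall>S. seq_over G S \<and> size S \<ge> davenport G - 1 \<longrightarrow>
        \<not> (\<exists>H. subgroup H G \<and> H \<noteq> {\<one>\<^bsub>G\<^esub>} \<and> H \<subseteq> extremal_set G S))"

lemma (in comm_monoid) num_subsums_list_cong_mset:
  assumes "mset xs = mset ys" and "set ys \<subseteq> carrier G"
  shows "num_subsums_list G g xs = num_subsums_list G g ys"
proof -
  obtain f where f: "bij_betw f {..<length xs} {..<length ys}"
    and nth: "\<And>i. i < length xs \<Longrightarrow> xs ! i = ys ! f i"
    using permutation_Ex_bij[OF assms(1)] by blast
  have prod_eq: "finprod G (\<lambda>i. ys ! i) (f ` I) = finprod G (\<lambda>i. xs ! i) I"
    if I: "I \<subseteq> {..<length xs}" for I
  proof -
    have inj: "inj_on f I"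
      using f I by (meson bij_betw_imp_inj_on inj_on_subset)
    have sub: "f ` I \<subseteq> {..<length ys}"
      using f I by (metis bij_betw_imp_surj_on image_mono)
    have "(\<lambda>i. ys ! i) \<in> f ` I \<rightarrow> carrier G"
    proof
      fix j assume "j \<in> f ` I"
      then have "j < length ys" using sub by auto
      then show "ys ! j \<in> carrier G" using assms(2) nth_mem by blast
    qed
    then have "finprod G (\<lambda>i. ys ! i) (f ` I) = finprod G (\<lambda>i. ys ! f i) I"
      using inj by (rule finprod_reindex)
    also have "\<dots> = finprod G (\<lambda>i. xs ! i) I"
    proof (rule finprod_cong')
      show "(\<lambda>i. xs ! i) \<in> I \<rightarrow> carrier G"
      proof
        fix i assume "i \<in> I"
        then have "i < length xs" using I by auto
        then have "xs ! i \<in> set xs" by simp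
        also have "set xs = set ys" using assms(1) by (rule mset_eq_setD)
        finally show "xs ! i \<in> carrier G" using assms(2) by blast
      qed
      show "ys ! f i = xs ! i" if "i \<in> I" for i
        using nth[of i] I that by auto
    qed simp
    finally show ?thesis .
  qed
  let ?A = "{I. I \<subseteq> {..<length xs} \<and> finprod G (\<lambda>i. xs ! i) I = g}"
  let ?B = "{I. I \<subseteq> {..<length ys} \<and> finprod G (\<lambda>i. ys ! i) I = g}"
  have bij: "bij_betw (image f) (Pow {..<length xs}) (Pow {..<length ys})"
    using f by (rule bij_betw_Pow)
  have img: "image f ` ?A = ?B"
  proof
    show "image f ` ?A \<subseteq> ?B"
    proof
      fix J assume "J \<in> image f ` ?A"
      then obtain I where I: "I \<subseteq> {..<length xs}" "finprod G (\<lambda>i. xs ! i) I = g" "J = f ` I"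
        by blast
      have "f ` I \<subseteq> {..<length ys}"
        using f I(1) by (metis bij_betw_imp_surj_on image_mono)
      then show "J \<in> ?B" using prod_eq[OF I(1)] I by simp
    qed
    show "?B \<subseteq> image f ` ?A"
    proof
      fix J assume J: "J \<in> ?B"
      then have "J \<in> image f ` Pow {..<length xs}"
        using bij by (simp add: bij_betw_def)
      then obtain I where I: "I \<subseteq> {..<length xs}" "J = f ` I" by blast
      then have "I \<in> ?A" using J prod_eq[OF I(1)] by simp
      then show "J \<in> image f ` ?A" using I(2) by blast
    qed
  qed
  have "inj_on (image f) ?A"
    by (rule inj_on_subset[OF bij_betw_imp_inj_on[OF bij]]) blast
  then have "card (image f ` ?A) = card ?A"
    by (rule card_image)
  then have "card ?A = card ?B"
    unfolding img by (rule sym)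
  then show ?thesis by (simp add: num_subsums_list_def)
qed

lemma (in comm_monoid) num_subsums_mset:
  assumes "set xs \<subseteq> carrier G"
  shows "num_subsums G g (mset xs) =
    card {I. I \<subseteq> {..<length xs} \<and> finprod G (\<lambda>i. xs ! i) I = g}"
proof -
  have "mset (SOME ys. mset ys = mset xs) = mset xs"
    by (rule someI[of "\<lambda>ys. mset ys = mset xs" xs]) simp
  from num_subsums_list_cong_mset[OF this assms] show ?thesis
    unfolding num_subsums_def by (simp only: num_subsums_list_def[of G g xs])
qed

end

theory Submission
  imports Defs
begin

text \<open>
  Olson's theorem says that every \<open>N\<^sub>g(S)\<close> is \<open>0\<close> or at least \<open>2\<^bsup>|S|-D(G)+1\<^esup>\<close>. (i) \<open>\<Longrightarrow>\<close> (ii):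
  \<open>|S| - D(G) + 1\<close> disjoint zero-sum subsequences of length at least \<open>2\<close> force \<open>|S| \<le> 2 D(G) - 2\<close>.
  The equivalences form the cycle (ii) \<open>\<Longrightarrow>\<close> (iii) \<open>\<Longrightarrow>\<close> (iv) \<open>\<Longrightarrow>\<close> (ii). If (iii) fails for \<open>H = {0, h}\<close>,
  lift a longest zero-sum free sequence over \<open>G/H\<close> and append arbitrarily many copies of \<open>h\<close>. If \<open>E(S)\<close>
  contains a cyclic group \<open>H\<close> of order \<open>n\<close>, summing \<open>N\<^sub>h(S)\<close> over \<open>H\<close> and applying Olson's theorem in
  \<open>G/H\<close> gives \<open>2\<^bsup>n-1\<^esup> \<le> 2\<^bsup>D(G)-D(G/H)\<^esup> \<le> n\<close>, hence \<open>n = 2\<close> and \<open>D(G) \<le> D(G/H) + 1\<close>. A long extremal \<open>S\<close>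
  contains some \<open>x \<noteq> 0\<close> many times; since \<open>N\<^sub>g(S) = N\<^sub>g(S x\<^sup>-\<^sup>1) + N\<^bsub>g-x\<^esub>(S x\<^sup>-\<^sup>1)\<close>, removing \<open>j\<close> copies of \<open>x\<close>
  makes \<open>0, -x, \<dots>, -j x\<close> extremal, and eventually these fill the subgroup generated by \<open>x\<close>.
\<close>

section \<open>Finite sets and multisets\<close>

lemma card_Collect_subset_insert:
  assumes "finite A" "a \<notin> A"
  shows "card {I. I \<subseteq> insert a A \<and> P I} = card {I. I \<subseteq> A \<and> P I} + card {I. I \<subseteq> A \<and> P (insert a I)}"
    (is "card ?L = card ?P + card ?Q")
proof -
  have "?L = {I \<in> Pow (insert a A). P I}" by auto
  also have "\<dots> = ?P \<union> insert a ` ?Q" unfolding Pow_insert by auto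
  also have "card \<dots> = card ?P + card (insert a ` ?Q)"
    using assms by (intro card_Un_disjoint) auto
  also have "card (insert a ` ?Q) = card ?Q"
    using assms(2) by (intro card_image inj_onI) (metis insert_ident mem_Collect_eq subsetD)
  finally show ?thesis .
qed

lemma ex_count_greater:
  assumes "finite A" "set_mset S \<subseteq> A" "card A * k < size S"
  shows "\<exists>x\<in>#S. k < count S x"
proof (rule ccontr)
  assume "\<not> ?thesis"
  then have "size S \<le> card (set_mset S) * k"
    unfolding size_multiset_overloaded_eq using sum_bounded_above[of "set_mset S" "count S" k]
    by (simp add: not_less)
  also have "\<dots> \<le> card A * k" using assms by (simp add: card_mono)
  finally show False using assms(3) by simp
qed

lemma subseteq_add_mset_iff:
  "T \<subseteq># add_mset x S \<longleftrightarrow> T \<subseteq># S \<or> (\<exists>U. T = add_mset x U \<and> U \<subseteq># S)"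
proof
  assume T: "T \<subseteq># add_mset x S"
  show "T \<subseteq># S \<or> (\<exists>U. T = add_mset x U \<and> U \<subseteq># S)"
  proof (cases "x \<in># T")
    case True
    then obtain U where "T = add_mset x U" by (rule mset_add)
    then show ?thesis using T by simp
  next
    case False
    then show ?thesis using T by (metis add_mset_add_single diff_single_trivial subset_eq_diff_conv)
  qed
next
  assume "T \<subseteq># S \<or> (\<exists>U. T = add_mset x U \<and> U \<subseteq># S)"
  then show "T \<subseteq># add_mset x S"
    by (metis add_mset_add_single mset_subset_eq_add_left mset_subset_eq_add_mset_cancel
        subset_mset.order_trans)
qed

lemma subseteq_union_msetE:
  assumes "T \<subseteq># A + B"
  obtains A' B' where "T = A' + B'" "A' \<subseteq># A" "B' \<subseteq># B"
proof
  show "T = T \<inter># A + (T - A)" by (rule multiset_eqI) simp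
  show "T - A \<subseteq># B" using assms by (simp add: subset_eq_diff_conv add.commute)
qed simp

lemma sum_disjoint_mset_subseteq:
  assumes "\<And>T. T \<in> A \<Longrightarrow> T \<subseteq># S"
    and "\<And>T U. T \<in> A \<Longrightarrow> U \<in> A \<Longrightarrow> T \<noteq> U \<Longrightarrow> T \<inter># U = {#}"
  shows "\<Sum>A \<subseteq># S"
  using assms
proof (induction A rule: infinite_finite_induct)
  case (insert T F)
  have "T \<inter># U = {#}" if "U \<in> F" for U
    using that insert.hyps(2) by (intro insert.prems(2)) auto
  then have "T \<inter># \<Sum>F = {#}" using insert.hyps(1) by (auto simp: disjunct_not_in set_mset_sum)
  then have "T + \<Sum>F = T \<union># \<Sum>F" by (metis diff_empty union_diff_inter_eq_sup)
  moreover have "T \<subseteq># S" "\<Sum>F \<subseteq># S" using insert by simp_all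
  ultimately show ?case using insert.hyps by simp
qed simp_all

section \<open>Sequences over a group\<close>

lemma seq_over_empty [simp]: "seq_over G {#}"
  by (simp add: seq_over_def)

lemma seq_over_add_mset [simp]: "seq_over G (add_mset x S) \<longleftrightarrow> x \<in> carrier G \<and> seq_over G S"
  by (simp add: seq_over_def)

lemma seq_over_union [simp]: "seq_over G (S + T) \<longleftrightarrow> seq_over G S \<and> seq_over G T"
  by (auto simp: seq_over_def)

lemma seq_over_subseteq: "seq_over G S \<Longrightarrow> T \<subseteq># S \<Longrightarrow> seq_over G T"
  unfolding seq_over_def by (meson set_mset_mono subset_trans)

lemma seq_over_replicate_mset: "x \<in> carrier G \<Longrightarrow> seq_over G (replicate_mset k x)"
  by (induction k) auto

lemma seq_over_mset: "seq_over G (mset xs) \<longleftrightarrow> set xs \<subseteq> carrier G"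
  by (simp add: seq_over_def)

definition subsums :: "('a, 'b) monoid_scheme \<Rightarrow> 'a multiset \<Rightarrow> 'a set" where
  "subsums G S = seq_sum G ` {T. T \<subseteq># S}"

definition zero_sum_free :: "('a, 'b) monoid_scheme \<Rightarrow> 'a multiset \<Rightarrow> bool" where
  "zero_sum_free G S \<longleftrightarrow> (\<forall>T. T \<subseteq># S \<and> T \<noteq> {#} \<longrightarrow> seq_sum G T \<noteq> \<one>\<^bsub>G\<^esub>)"

lemma zero_sum_freeD: "zero_sum_free G S \<Longrightarrow> T \<subseteq># S \<Longrightarrow> seq_sum G T = \<one>\<^bsub>G\<^esub> \<Longrightarrow> T = {#}"
  by (auto simp: zero_sum_free_def)

context comm_group
begin

lemma seq_sum_empty [simp]: "seq_sum G {#} = \<one>"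
  by (simp add: seq_sum_def)

lemma seq_sum_closed [simp]: "seq_over G S \<Longrightarrow> seq_sum G S \<in> carrier G"
  unfolding seq_sum_def seq_over_def by (rule finprod_closed) auto

lemma seq_sum_superset:
  assumes "finite A" "set_mset S \<subseteq> A" "A \<subseteq> carrier G"
  shows "seq_sum G S = (\<Otimes>x\<in>A. x [^] count S x)"
  unfolding seq_sum_def
  using assms by (intro finprod_mono_neutral_cong_left) (auto simp: not_in_iff)

lemma seq_sum_union [simp]:
  assumes "seq_over G S" "seq_over G T"
  shows "seq_sum G (S + T) = seq_sum G S \<otimes> seq_sum G T"
proof -
  let ?A = "set_mset S \<union> set_mset T"
  have A: "?A \<subseteq> carrier G" using assms by (simp add: seq_over_def)
  have "seq_sum G (S + T) = (\<Otimes>x\<in>?A. x [^] count (S + T) x)"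
    using A by (intro seq_sum_superset) auto
  also have "\<dots> = (\<Otimes>x\<in>?A. x [^] count S x \<otimes> x [^] count T x)"
    using A by (intro finprod_cong') (auto simp: nat_pow_mult)
  also have "\<dots> = (\<Otimes>x\<in>?A. x [^] count S x) \<otimes> (\<Otimes>x\<in>?A. x [^] count T x)"
    using A by (intro finprod_multf) auto
  also have "\<dots> = seq_sum G S \<otimes> seq_sum G T"
    using A by (simp add: seq_sum_superset[of ?A])
  finally show ?thesis .
qed

lemma seq_sum_add_mset [simp]:
  assumes "x \<in> carrier G" "seq_over G S"
  shows "seq_sum G (add_mset x S) = x \<otimes> seq_sum G S"
proof -
  have "seq_sum G {#x#} = x" using assms(1) by (simp add: seq_sum_def)
  then show ?thesis using seq_sum_union[of "{#x#}" S] assms by simp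
qed

lemma seq_sum_replicate_mset [simp]:
  assumes "x \<in> carrier G"
  shows "seq_sum G (replicate_mset k x) = x [^] k"
  using assms by (induction k) (auto simp: m_comm seq_over_replicate_mset)

lemma one_in_subsums [simp]: "\<one> \<in> subsums G S"
  unfolding subsums_def by (rule image_eqI[of _ _ "{#}"]) simp_all

lemma subsums_empty [simp]: "subsums G {#} = {\<one>}"
  by (simp add: subsums_def)

lemma subsums_add_mset:
  assumes "x \<in> carrier G" "seq_over G S"
  shows "subsums G (add_mset x S) = subsums G S \<union> (\<otimes>) x ` subsums G S"
proof -
  have "{T. T \<subseteq># add_mset x S} = {T. T \<subseteq># S} \<union> add_mset x ` {T. T \<subseteq># S}"
    by (auto simp: subseteq_add_mset_iff)
  moreover have "seq_sum G (add_mset x T) = x \<otimes> seq_sum G T" if "T \<subseteq># S" for T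
    using that assms by (simp add: seq_over_subseteq)
  ultimately show ?thesis by (auto simp: subsums_def image_Un image_image)
qed

lemma subsums_closed: "seq_over G S \<Longrightarrow> subsums G S \<subseteq> carrier G"
  by (auto simp: subsums_def intro: seq_sum_closed seq_over_subseteq)

lemma in_subsums_add_mset_iff:
  assumes "x \<in> carrier G" "seq_over G S" "g \<in> carrier G"
  shows "g \<in> subsums G (add_mset x S) \<longleftrightarrow> g \<in> subsums G S \<or> g \<otimes> inv x \<in> subsums G S"
proof -
  have "g \<in> (\<otimes>) x ` subsums G S \<longleftrightarrow> g \<otimes> inv x \<in> subsums G S"
  proof
    assume "g \<in> (\<otimes>) x ` subsums G S"
    then obtain y where y: "y \<in> subsums G S" "g = x \<otimes> y" by blast
    have "y \<in> carrier G" using y(1) subsums_closed[OF assms(2)] by blast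
    then have "g \<otimes> inv x = y" using y(2) assms(1) by (simp add: m_comm[of x y] m_assoc)
    then show "g \<otimes> inv x \<in> subsums G S" using y(1) by simp
  next
    assume "g \<otimes> inv x \<in> subsums G S"
    moreover have "g = x \<otimes> (g \<otimes> inv x)" using assms by (simp add: m_lcomm)
    ultimately show "g \<in> (\<otimes>) x ` subsums G S" by blast
  qed
  then show ?thesis using subsums_add_mset[OF assms(1,2)] by blast
qed

lemma zero_sum_free_empty [simp]: "zero_sum_free G {#}"
  by (simp add: zero_sum_free_def)

lemma zero_sum_free_add_mset_iff:
  assumes "x \<in> carrier G" "seq_over G S"
  shows "zero_sum_free G (add_mset x S) \<longleftrightarrow> zero_sum_free G S \<and> inv x \<notin> subsums G S"
proof -
  have "seq_sum G (add_mset x U) = \<one> \<longleftrightarrow> seq_sum G U = inv x" if "U \<subseteq># S" for U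
  proof -
    have "seq_over G U" using assms(2) that by (rule seq_over_subseteq)
    then show ?thesis using assms(1) by (metis comm_inv_char r_inv seq_sum_add_mset seq_sum_closed)
  qed
  then show ?thesis
    by (auto simp: zero_sum_free_def subsums_def subseteq_add_mset_iff image_iff)
qed

lemma zero_sum_free_one_notin:
  assumes "zero_sum_free G S"
  shows "\<one> \<notin># S"
  using zero_sum_freeD[OF assms, of "{#\<one>#}"] by auto

lemma not_zero_sum_freeE:
  assumes "seq_over G S" "\<not> zero_sum_free G S"
  obtains x R where "S = add_mset x R" "x \<in> carrier G" "seq_over G R" "inv x \<in> subsums G R"
proof -
  obtain T where T: "T \<subseteq># S" "T \<noteq> {#}" "seq_sum G T = \<one>"
    using assms(2) unfolding zero_sum_free_def by blast
  obtain x U where U: "T = add_mset x U" using T(2) by (meson multiset_cases)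
  then obtain R where R: "S = add_mset x R" using T(1) by (metis mset_add insert_subset_eq_iff)
  have over: "x \<in> carrier G" "seq_over G R" "U \<subseteq># R" using assms(1) T(1) U R by auto
  then have "seq_over G U" by (metis seq_over_subseteq)
  then have "seq_sum G U = inv x"
    using T(3) U over(1) by (metis comm_inv_char seq_sum_add_mset seq_sum_closed)
  then have "inv x \<in> subsums G R"
    using over(3) unfolding subsums_def by (metis image_eqI mem_Collect_eq)
  then show thesis using that R over by blast
qed

lemma zero_sum_free_replicate_mset:
  assumes "x \<in> carrier G" "k < ord x"
  shows "zero_sum_free G (replicate_mset k x)"
  unfolding zero_sum_free_def
proof (intro allI impI notI, elim conjE)
  fix T assume T: "T \<subseteq># replicate_mset k x" "T \<noteq> {#}" "seq_sum G T = \<one>"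
  obtain m where m: "m \<le> k" "T = replicate_mset m x" using msubseteq_replicate_msetE[OF T(1)] .
  then have "ord x dvd m" "m \<noteq> 0" using T assms(1) by (auto simp: pow_eq_id)
  then have "ord x \<le> m" by (simp add: dvd_imp_le)
  then show False using m(1) assms(2) by simp
qed

lemma zero_sum_free_count_less_ord:
  assumes "zero_sum_free G S" "x \<in> carrier G" "0 < ord x"
  shows "count S x < ord x"
proof (rule ccontr)
  assume "\<not> ?thesis"
  then have "replicate_mset (ord x) x \<subseteq># S" by (simp flip: count_le_replicate_mset_subset_eq)
  then have "replicate_mset (ord x) x = {#}"
    using assms(2) by (intro zero_sum_freeD[OF assms(1)]) simp_all
  then show False using assms(3) by simp
qed

lemma inv_in_subsums:
  assumes "x \<in> carrier G" "0 < ord x" "ord x \<le> Suc (count S x)"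
  shows "inv x \<in> subsums G S"
proof -
  have "x \<otimes> x [^] (ord x - 1) = x [^] ord x"
    using assms(1,2) by (metis Suc_pred' nat_pow_Suc2)
  then have "inv x = seq_sum G (replicate_mset (ord x - 1) x)"
    using assms(1) by (simp add: comm_inv_char)
  moreover have "replicate_mset (ord x - 1) x \<subseteq># S"
    using assms(3) by (simp flip: count_le_replicate_mset_subset_eq)
  ultimately show ?thesis unfolding subsums_def by blast
qed

section \<open>Counting index sets with a given sum\<close>

lemma num_subsums_empty: "num_subsums G g {#} = (if g = \<one> then 1 else 0)"
proof -
  have "num_subsums G g {#} = card {I::nat set. I \<subseteq> {} \<and> finprod G ((!) []) I = g}"
    using num_subsums_mset[of "[]" g] by simp
  also have "{I::nat set. I \<subseteq> {} \<and> finprod G ((!) []) I = g} = (if g = \<one> then {{}} else {})"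
    by auto
  finally show ?thesis by simp
qed

lemma num_subsums_add_mset:
  assumes "x \<in> carrier G" "seq_over G S" "g \<in> carrier G"
  shows "num_subsums G g (add_mset x S) = num_subsums G g S + num_subsums G (g \<otimes> inv x) S"
proof -
  obtain xs where xs: "mset xs = S" using ex_mset by blast
  let ?n = "length xs" and ?ys = "xs @ [x]"
  have xs_carrier: "set xs \<subseteq> carrier G" using assms(2) unfolding xs[symmetric] seq_over_mset .
  have nth_closed: "(!) xs \<in> I \<rightarrow> carrier G" if "I \<subseteq> {..<?n}" for I
    using that xs_carrier nth_mem by (fastforce simp: subset_iff)
  have ys_eq: "finprod G ((!) ?ys) I = finprod G ((!) xs) I" if "I \<subseteq> {..<?n}" for I
    using that by (intro finprod_cong'[OF refl nth_closed]) (auto simp: nth_append)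
  have ys_insert: "finprod G ((!) ?ys) (insert ?n I) = g \<longleftrightarrow> finprod G ((!) xs) I = g \<otimes> inv x"
    if I: "I \<subseteq> {..<?n}" for I
  proof -
    have "finprod G ((!) ?ys) (insert ?n I) = ?ys ! ?n \<otimes> finprod G ((!) ?ys) I"
      using I assms(1) nth_closed[OF I] finite_subset[OF I]
      by (intro finprod_insert) (auto simp: nth_append Pi_iff)
    also have "\<dots> = finprod G ((!) xs) I \<otimes> x"
      using I assms(1) nth_closed[OF I] by (simp add: ys_eq m_comm)
    finally show ?thesis
      using assms(1,3) finprod_closed[OF nth_closed[OF I]] by (auto simp: inv_solve_right)
  qed
  have "num_subsums G g (mset ?ys) = card {I. I \<subseteq> insert ?n {..<?n} \<and> finprod G ((!) ?ys) I = g}"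
    using xs_carrier assms(1) num_subsums_mset[of ?ys g] by (simp add: lessThan_Suc)
  also have "\<dots> = card {I. I \<subseteq> {..<?n} \<and> finprod G ((!) xs) I = g}
      + card {I. I \<subseteq> {..<?n} \<and> finprod G ((!) xs) I = g \<otimes> inv x}"
    using ys_eq ys_insert by (subst card_Collect_subset_insert) (simp_all cong: conj_cong)
  also have "\<dots> = num_subsums G g S + num_subsums G (g \<otimes> inv x) S"
    using num_subsums_mset[OF xs_carrier] xs by simp
  finally show ?thesis using xs by simp
qed

lemma num_subsums_pos_iff:
  assumes "seq_over G S" "g \<in> carrier G"
  shows "0 < num_subsums G g S \<longleftrightarrow> g \<in> subsums G S"
  using assms
  by (induction S arbitrary: g)
    (auto simp: num_subsums_empty num_subsums_add_mset in_subsums_add_mset_iff)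

lemma num_subsums_one_eq_1_iff:
  assumes "seq_over G S"
  shows "num_subsums G \<one> S = 1 \<longleftrightarrow> zero_sum_free G S"
  using assms
proof (induction S)
  case empty
  then show ?case by (simp add: num_subsums_empty)
next
  case (add x S)
  then have over: "x \<in> carrier G" "seq_over G S" by auto
  have "num_subsums G \<one> S \<noteq> 0" using num_subsums_pos_iff[OF over(2) one_closed] by simp
  then have "num_subsums G \<one> (add_mset x S) = 1 \<longleftrightarrow>
      num_subsums G \<one> S = 1 \<and> num_subsums G (inv x) S = 0"
    using num_subsums_add_mset[OF over one_closed] over(1) by auto
  also have "\<dots> \<longleftrightarrow> zero_sum_free G (add_mset x S)"
    using add.IH[OF over(2)] num_subsums_pos_iff[OF over(2), of "inv x"] over
    by (auto simp: zero_sum_free_add_mset_iff)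
  finally show ?case .
qed

lemma num_subsums_invert:
  assumes "seq_over G S" "seq_over G T" "g \<in> carrier G"
  shows "num_subsums G g (T + S)
    = num_subsums G (g \<otimes> inv seq_sum G T) (image_mset (m_inv G) T + S)"
  using assms
proof (induction T arbitrary: g S)
  case empty
  then show ?case by simp
next
  case (add x T)
  let ?iT = "image_mset (m_inv G) T" and ?h = "g \<otimes> inv seq_sum G T"
  have closed: "x \<in> carrier G" "seq_over G T" "seq_over G (?iT + S)" "?h \<in> carrier G"
    using add.prems by (auto simp: seq_over_def)
  have "num_subsums G g (T + add_mset x S) = num_subsums G ?h (?iT + add_mset x S)"
    using add.prems by (intro add.IH) auto
  also have "\<dots> = num_subsums G ?h (?iT + S) + num_subsums G (?h \<otimes> inv x) (?iT + S)"
    using num_subsums_add_mset[OF closed(1,3,4)] by simp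
  also have "\<dots> = num_subsums G (?h \<otimes> inv x) (add_mset (inv x) (?iT + S))"
    using num_subsums_add_mset[of "inv x" "?iT + S" "?h \<otimes> inv x"] closed by (simp add: m_assoc)
  also have "?h \<otimes> inv x = g \<otimes> inv seq_sum G (add_mset x T)"
    using closed add.prems(3) by (simp add: inv_mult m_comm m_lcomm)
  finally show ?case by simp
qed

text \<open>Invert the terms of a subsequence with sum \<open>g\<close>.\<close>

lemma num_subsums_eq_num_subsums_one:
  assumes "seq_over G S" "g \<in> subsums G S"
  obtains S' where "seq_over G S'" "size S' = size S" "num_subsums G \<one> S' = num_subsums G g S"
proof -
  obtain T where T: "T \<subseteq># S" "seq_sum G T = g" using assms(2) by (auto simp: subsums_def)
  let ?S' = "image_mset (m_inv G) T + (S - T)"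
  have over: "seq_over G T" "seq_over G (S - T)" using assms(1) T(1) by (auto intro: seq_over_subseteq)
  have "seq_over G ?S'" using over by (auto simp: seq_over_def)
  moreover have "size ?S' = size S"
    using T(1) by (metis size_image_mset size_union subset_mset.add_diff_inverse)
  moreover have "num_subsums G \<one> ?S' = num_subsums G g S"
    using num_subsums_invert[OF over(2,1), of g] over(1) T by auto
  ultimately show thesis by (rule that)
qed

lemma num_subsums_replicate_mset_involution:
  assumes "h \<in> carrier G" "h \<otimes> h = \<one>" "seq_over G S" "g \<in> carrier G"
  shows "num_subsums G g (replicate_mset (Suc k) h + S)
    = 2 ^ k * (num_subsums G g S + num_subsums G (g \<otimes> h) S)"
proof -
  have inv_h: "inv h = h" using assms(1,2) by (simp add: inv_equality)
  show ?thesis using assms(4)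
  proof (induction k arbitrary: g)
    case 0
    then show ?case using num_subsums_add_mset[OF assms(1,3) 0] inv_h by simp
  next
    case (Suc k)
    have "seq_over G (replicate_mset (Suc k) h + S)"
      using assms(1,3) by (simp add: seq_over_replicate_mset)
    from num_subsums_add_mset[OF assms(1) this Suc.prems]
    show ?case using Suc.IH[OF Suc.prems] Suc.IH[of "g \<otimes> h"] Suc.prems assms(1,2) inv_h
      by (simp add: m_assoc)
  qed
qed

end

section \<open>Cyclic subgroups\<close>

lemma (in group) generate_iso_integer_mod_group:
  assumes "a \<in> carrier G"
  shows "G\<lparr>carrier := generate G {a}\<rparr> \<cong> integer_mod_group (ord a)"
proof -
  let ?Z = "integer_mod_group (ord a)" and ?H = "G\<lparr>carrier := generate G {a}\<rparr>"
  let ?f = "\<lambda>k::int. a [^] k"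
  have pow_mod: "a [^] (k mod int (ord a)) = a [^] k" for k :: int
    using assms by (simp add: int_pow_eq minus_mod_eq_mult_div)
  have mod_carrier: "k mod int (ord a) \<in> carrier ?Z" for k
    by (simp add: carrier_integer_mod_group)
  have "?f \<in> hom ?Z ?H"
    using assms by (auto simp: hom_def generate_pow pow_mod int_pow_mult)
  moreover have "inj_on ?f (carrier ?Z)"
    using assms
    by (auto simp: inj_on_def int_pow_eq carrier_integer_mod_group mod_eq_dvd_iff[symmetric])
  moreover have "?f ` carrier ?Z = carrier ?H"
  proof -
    have "a [^] k \<in> ?f ` carrier ?Z" for k :: int
      using mod_carrier[of k] pow_mod[of k] by (metis image_eqI)
    then show ?thesis using assms by (auto simp: generate_pow)
  qed
  ultimately have "?f \<in> iso ?Z ?H" by (simp add: iso_def bij_betw_def)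
  then have "?Z \<cong> ?H" by (auto simp: is_iso_def)
  then show ?thesis by (rule group.iso_sym[OF group_integer_mod_group])
qed

lemma (in group) subgroup_card_twoE:
  assumes "subgroup H G" "card H = 2"
  obtains h where "h \<in> carrier G" "h \<noteq> \<one>" "H = {\<one>, h}" "h \<otimes> h = \<one>"
proof -
  obtain h where h: "H = {\<one>, h}" "h \<noteq> \<one>"
    using assms(2) subgroup.one_closed[OF assms(1)]
    by (metis card_2_iff insert_commute insertE singletonD)
  then have h_carrier: "h \<in> carrier G" using subgroup.subset[OF assms(1)] by blast
  have "h \<otimes> h \<in> H" using h(1) subgroup.m_closed[OF assms(1)] by blast
  then have "h \<otimes> h = \<one>" using h h_carrier by (metis insertE l_cancel_one singletonD)
  then show thesis using that h_carrier h by blast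
qed

section \<open>Homomorphic images\<close>

locale comm_group_hom = G: comm_group G + K: comm_group K
  for G (structure) and K (structure) +
  fixes f
  assumes hom: "f \<in> hom G K"

sublocale comm_group_hom \<subseteq> group_hom G K f
  using hom by unfold_locales

context comm_group_hom
begin

lemma seq_over_image: "seq_over G S \<Longrightarrow> seq_over K (image_mset f S)"
  by (auto simp: seq_over_def)

lemma seq_sum_image:
  assumes "seq_over G S"
  shows "seq_sum K (image_mset f S) = f (seq_sum G S)"
  using assms by (induction S) (simp_all add: seq_over_image)

lemma seq_preimageE:
  assumes "f ` carrier G = carrier K" "seq_over K S'"
  obtains S where "seq_over G S" "image_mset f S = S'"
proof
  let ?S = "image_mset (inv_into (carrier G) f) S'"
  have in_image: "y \<in> f ` carrier G" if "y \<in># S'" for y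
    using assms that by (auto simp: seq_over_def)
  show "seq_over G ?S" using in_image by (auto simp: seq_over_def inv_into_into)
  have "image_mset f ?S = image_mset id S'"
    unfolding multiset.map_comp using in_image
    by (intro multiset.map_cong) (simp_all add: f_inv_into_f)
  then show "image_mset f ?S = S'" by simp
qed

lemma num_subsums_image:
  assumes "finite (carrier G)" "seq_over G S" "k \<in> carrier K"
  shows "num_subsums K k (image_mset f S) = (\<Sum>g | g \<in> carrier G \<and> f g = k. num_subsums G g S)"
  using assms(2,3)
proof (induction S arbitrary: k)
  case empty
  then show ?case using assms(1) by (auto simp: G.num_subsums_empty K.num_subsums_empty)
next
  case (add x S)
  let ?F = "\<lambda>k. {g. g \<in> carrier G \<and> f g = k}"
  have x: "x \<in> carrier G" "seq_over G S" using add.prems by auto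
  then have quotient_closed: "k \<otimes>\<^bsub>K\<^esub> inv\<^bsub>K\<^esub> f x \<in> carrier K" using add.prems by simp
  have shift: "(\<Sum>g\<in>?F k. num_subsums G (g \<otimes> inv x) S)
      = (\<Sum>g\<in>?F (k \<otimes>\<^bsub>K\<^esub> inv\<^bsub>K\<^esub> f x). num_subsums G g S)"
    using x add.prems(2)
    by (intro sum.reindex_bij_witness[of _ "\<lambda>g. g \<otimes> x" "\<lambda>g. g \<otimes> inv x"])
      (auto simp: G.m_assoc K.m_assoc)
  have "num_subsums K k (image_mset f (add_mset x S)) = num_subsums K k (image_mset f S)
      + num_subsums K (k \<otimes>\<^bsub>K\<^esub> inv\<^bsub>K\<^esub> f x) (image_mset f S)"
    using K.num_subsums_add_mset[OF _ seq_over_image[OF x(2)] add.prems(2)] x(1) by simp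
  also have "\<dots> = (\<Sum>g\<in>?F k. num_subsums G g S + num_subsums G (g \<otimes> inv x) S)"
    using add.IH x(2) add.prems(2) quotient_closed by (simp add: shift sum.distrib)
  also have "\<dots> = (\<Sum>g\<in>?F k. num_subsums G g (add_mset x S))"
    using x by (intro sum.cong) (simp_all add: G.num_subsums_add_mset)
  finally show ?case .
qed

lemma zero_sum_free_union_kernel:
  assumes "seq_over G S" "zero_sum_free K (image_mset f S)"
    and "seq_over G T" "zero_sum_free G T" "\<And>x. x \<in># T \<Longrightarrow> f x = \<one>\<^bsub>K\<^esub>"
  shows "zero_sum_free G (S + T)"
  unfolding zero_sum_free_def
proof (intro allI impI notI, elim conjE)
  fix U assume U: "U \<subseteq># S + T" "U \<noteq> {#}" "seq_sum G U = \<one>"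
  obtain A B where AB: "U = A + B" "A \<subseteq># S" "B \<subseteq># T" using subseteq_union_msetE[OF U(1)] .
  have AB_over: "seq_over G A" "seq_over G B" using AB assms(1,3) seq_over_subseteq by blast+
  have "image_mset f B = image_mset (\<lambda>_. \<one>\<^bsub>K\<^esub>) B"
    using assms(5) AB(3) by (intro image_mset_cong) (meson mset_subset_eqD)
  then have "f (seq_sum G B) = \<one>\<^bsub>K\<^esub>"
    using seq_sum_image[OF AB_over(2)] by (simp add: image_mset_const_eq)
  moreover have "f (seq_sum G A) \<otimes>\<^bsub>K\<^esub> f (seq_sum G B) = f (seq_sum G U)"
    using AB_over AB(1) by simp
  ultimately have "seq_sum K (image_mset f A) = \<one>\<^bsub>K\<^esub>"
    using U(3) AB_over by (simp add: seq_sum_image)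
  then have "A = {#}"
    using zero_sum_freeD[OF assms(2) image_mset_subseteq_mono[OF AB(2)]] by simp
  then have "B = {#}" using zero_sum_freeD[OF assms(4) AB(3)] AB(1) U(3) by simp
  then show False using \<open>A = {#}\<close> AB(1) U(2) by simp
qed

end

lemma (in comm_group) comm_group_hom_FactGroup:
  assumes "subgroup H G"
  shows "comm_group_hom G (G Mod H) (\<lambda>x. H #> x)"
  using normal.r_coset_hom_Mod[OF subgroup_imp_normal[OF assms]] abelian_FactGroup[OF assms]
  by (simp add: comm_group_hom_def comm_group_hom_axioms_def comm_group_axioms)

lemma (in group) r_coset_eq_subgroup_iff:
  assumes "subgroup H G" "x \<in> carrier G"
  shows "H #> x = H \<longleftrightarrow> x \<in> H"
  using assms by (metis coset_join1 coset_join2)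

lemma (in comm_group) num_subsums_FactGroup_one:
  assumes "finite (carrier G)" "subgroup H G" "seq_over G S"
  shows "num_subsums (G Mod H) \<one>\<^bsub>G Mod H\<^esub> (image_mset (\<lambda>x. H #> x) S)
    = (\<Sum>h\<in>H. num_subsums G h S)"
proof -
  interpret proj: comm_group_hom G "G Mod H" "\<lambda>x. H #> x"
    using assms(2) by (rule comm_group_hom_FactGroup)
  have "g \<in> carrier G \<and> H #> g = H \<longleftrightarrow> g \<in> H" for g
    using r_coset_eq_subgroup_iff[OF assms(2)] subgroup.mem_carrier[OF assms(2)] by blast
  then have "{g \<in> carrier G. H #> g = \<one>\<^bsub>G Mod H\<^esub>} = H" by simp
  then show ?thesis using proj.num_subsums_image[OF assms(1,3) proj.K.one_closed] by simp
qed

section \<open>The Davenport constant and Olson's theorem\<close>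

lemma davenport_eq_Least:
  "davenport G = (LEAST l. 0 < l \<and> (\<forall>S. seq_over G S \<and> zero_sum_free G S \<longrightarrow> size S < l))"
proof -
  have "(seq_over G S \<and> l \<le> size S \<longrightarrow> (\<exists>T. T \<subseteq># S \<and> T \<noteq> {#} \<and> seq_sum G T = \<one>\<^bsub>G\<^esub>)) \<longleftrightarrow>
      (seq_over G S \<and> zero_sum_free G S \<longrightarrow> size S < l)" for S l
    unfolding zero_sum_free_def linorder_not_le[symmetric] by blast
  then show ?thesis unfolding davenport_def by simp
qed

locale finite_comm_group = comm_group +
  assumes finite_carrier: "finite (carrier G)"

lemma (in finite_comm_group) finite_comm_group_FactGroup:
  assumes "subgroup H G"
  shows "finite_comm_group (G Mod H)"
  using abelian_FactGroup[OF assms] finite_carrier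
  by (simp add: finite_comm_group_def finite_comm_group_axioms_def carrier_FactGroup)

context finite_comm_group
begin

lemma ord_pos: "x \<in> carrier G \<Longrightarrow> 0 < ord x"
  using ord_ge_1[OF finite_carrier] by fastforce

lemma zero_sum_free_size_le_order_squared:
  assumes "seq_over G S" "zero_sum_free G S"
  shows "size S \<le> order G * order G"
proof (rule ccontr)
  assume "\<not> ?thesis"
  then obtain x where x: "x \<in># S" "order G < count S x"
    using ex_count_greater[OF finite_carrier, of S "order G"] assms(1)
    by (auto simp: seq_over_def order_def)
  then have "x \<in> carrier G" using assms(1) by (auto simp: seq_over_def)
  then show False
    using zero_sum_free_count_less_ord[OF assms(2)] ord_pos ord_le_group_order[OF finite_carrier] x(2)
    by (meson less_trans not_less)
qed

lemma zero_sum_free_size_less_davenport: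
  assumes "seq_over G S" "zero_sum_free G S"
  shows "size S < davenport G"
proof -
  let ?P = "\<lambda>l. 0 < l \<and> (\<forall>S. seq_over G S \<and> zero_sum_free G S \<longrightarrow> size S < l)"
  have "?P (Suc (order G * order G))"
    using zero_sum_free_size_le_order_squared by (simp add: less_Suc_eq_le)
  then have "?P (davenport G)" unfolding davenport_eq_Least by (rule LeastI)
  then show ?thesis using assms by blast
qed

lemma longest_zero_sum_freeE:
  obtains S where "seq_over G S" "zero_sum_free G S" "Suc (size S) = davenport G"
proof -
  define m where "m = davenport G - 1"
  have davenport_eq: "davenport G = Suc m"
    using zero_sum_free_size_less_davenport[of "{#}"] by (simp add: m_def)
  then have "m < davenport G" by simp
  then have "\<not> (0 < m \<and> (\<forall>S. seq_over G S \<and> zero_sum_free G S \<longrightarrow> size S < m))"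
    unfolding davenport_eq_Least by (rule not_less_Least)
  then consider "m = 0" | "\<exists>S. seq_over G S \<and> zero_sum_free G S \<and> m \<le> size S"
    by (auto simp: not_less)
  then obtain S where S: "seq_over G S" "zero_sum_free G S" "m \<le> size S"
    by cases (use that[of "{#}"] in auto)
  then have "Suc (size S) = davenport G"
    using zero_sum_free_size_less_davenport[OF S(1,2)] davenport_eq by simp
  then show thesis using that S by blast
qed

text \<open>Once \<open>N\<^sub>g\<close> is replaced by \<open>N\<^sub>0\<close>, a term of a zero-sum subsequence splits it into two positive
  numbers of the same kind.\<close>

lemma num_subsums_lower_bound:
  assumes "seq_over G S" "g \<in> subsums G S"
  shows "2 ^ Suc (size S) \<le> num_subsums G g S * 2 ^ davenport G"
  using assms
proof (induction "size S" arbitrary: S g rule: less_induct)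
  case less
  obtain S' where S': "seq_over G S'" "size S' = size S" "num_subsums G \<one> S' = num_subsums G g S"
    using num_subsums_eq_num_subsums_one[OF less.prems] .
  have "2 ^ Suc (size S') \<le> num_subsums G \<one> S' * 2 ^ davenport G"
  proof (cases "zero_sum_free G S'")
    case True
    then have "num_subsums G \<one> S' = 1" using num_subsums_one_eq_1_iff[OF S'(1)] by blast
    moreover have "Suc (size S') \<le> davenport G"
      using zero_sum_free_size_less_davenport[OF S'(1) True] by simp
    ultimately show ?thesis by (metis mult_1 one_le_numeral power_increasing)
  next
    case False
    then obtain x R where R: "S' = add_mset x R" "x \<in> carrier G" "seq_over G R" "inv x \<in> subsums G R"
      using not_zero_sum_freeE[OF S'(1)] by blast
    have "size R < size S" using R(1) S'(2) by simp
    then have "2 ^ Suc (size R) \<le> num_subsums G \<one> R * 2 ^ davenport G"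
      "2 ^ Suc (size R) \<le> num_subsums G (inv x) R * 2 ^ davenport G"
      using less.hyps R(3,4) by simp_all
    then show ?thesis
      using num_subsums_add_mset[OF R(2,3) one_closed] R(1,2) by (simp add: add_mult_distrib)
  qed
  then show ?case using S'(2,3) by simp
qed

end

lemma (in comm_group_hom) davenport_image_add_kernel:
  assumes "finite (carrier G)" "f ` carrier G = carrier K"
    and "seq_over G T" "zero_sum_free G T" "\<And>x. x \<in># T \<Longrightarrow> f x = \<one>\<^bsub>K\<^esub>"
  shows "davenport K + size T \<le> davenport G"
proof -
  interpret G: finite_comm_group G by unfold_locales (rule assms(1))
  have "finite (carrier K)" using assms(1) unfolding assms(2)[symmetric] by (rule finite_imageI)
  then interpret K: finite_comm_group K by unfold_locales
  obtain S' where S': "seq_over K S'" "zero_sum_free K S'" "Suc (size S') = davenport K"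
    by (rule K.longest_zero_sum_freeE)
  obtain S where S: "seq_over G S" "image_mset f S = S'" using seq_preimageE[OF assms(2) S'(1)] .
  have "zero_sum_free G (S + T)"
    by (rule zero_sum_free_union_kernel) (use S S'(2) assms in simp_all)
  then have "size (S + T) < davenport G"
    using S(1) assms(3) by (intro G.zero_sum_free_size_less_davenport) simp_all
  moreover have "size S = size S'" using S(2) by auto
  ultimately show ?thesis using S'(3) by simp
qed

lemma (in finite_comm_group) davenport_FactGroup_add_ord:
  assumes "subgroup H G" "h \<in> H"
  shows "davenport (G Mod H) + ord h \<le> Suc (davenport G)"
proof -
  interpret proj: comm_group_hom G "G Mod H" "\<lambda>x. H #> x"
    using assms(1) by (rule comm_group_hom_FactGroup)
  have h: "h \<in> carrier G" using assms by (rule subgroup.mem_carrier)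
  have "davenport (G Mod H) + size (replicate_mset (ord h - 1) h) \<le> davenport G"
  proof (rule proj.davenport_image_add_kernel[OF finite_carrier])
    show "(\<lambda>x. H #> x) ` carrier G = carrier (G Mod H)" by (simp add: carrier_FactGroup)
    show "zero_sum_free G (replicate_mset (ord h - 1) h)"
      using h ord_pos[OF h] by (intro zero_sum_free_replicate_mset) simp_all
    show "H #> x = \<one>\<^bsub>G Mod H\<^esub>" if "x \<in># replicate_mset (ord h - 1) h" for x
      using that assms h by (auto simp: r_coset_eq_subgroup_iff split: if_splits)
  qed (rule seq_over_replicate_mset[OF h])
  then show ?thesis by simp
qed

section \<open>Extremal sets\<close>

lemma attains_bound_iff:
  "attains_bound G g S \<longleftrightarrow> num_subsums G g S * 2 ^ davenport G = 2 ^ Suc (size S)"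
proof -
  have "(2::real) powi (int (size S) - int (davenport G) + 1)
      = 2 powi (int (Suc (size S)) - int (davenport G))"
    by (rule arg_cong[where f = "\<lambda>i. 2 powi i"]) simp
  also have "\<dots> = 2 ^ Suc (size S) / 2 ^ davenport G"
    by (subst power_int_diff) (simp_all only: power_int_of_nat, simp)
  finally have bound: "(2::real) powi (int (size S) - int (davenport G) + 1)
      = 2 ^ Suc (size S) / 2 ^ davenport G" .
  have "attains_bound G g S \<longleftrightarrow>
      real (num_subsums G g S) * 2 ^ davenport G = 2 ^ Suc (size S)"
    unfolding attains_bound_def bound by (simp add: eq_divide_eq)
  also have "\<dots> \<longleftrightarrow> real (num_subsums G g S * 2 ^ davenport G) = real (2 ^ Suc (size S))" by simp
  finally show ?thesis by (simp only: of_nat_eq_iff)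
qed

lemma in_extremal_set_iff:
  "g \<in> extremal_set G S \<longleftrightarrow>
    g \<in> carrier G \<and> num_subsums G g S * 2 ^ davenport G = 2 ^ Suc (size S)"
  by (simp add: extremal_set_def attains_bound_iff)

context finite_comm_group
begin

lemma extremal_set_add_mset_num_subsums:
  assumes "x \<in> carrier G" "seq_over G S" "g \<in> extremal_set G (add_mset x S)"
  shows "num_subsums G g S * 2 ^ davenport G + num_subsums G (g \<otimes> inv x) S * 2 ^ davenport G
    = 2 ^ Suc (size S) + 2 ^ Suc (size S)"
  using assms num_subsums_add_mset[OF assms(1,2), of g]
  by (simp add: in_extremal_set_iff add_mult_distrib)

lemma extremal_set_add_mset_shift_iff:
  assumes "x \<in> carrier G" "seq_over G S" "g \<in> extremal_set G (add_mset x S)"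
  shows "g \<otimes> inv x \<in> extremal_set G S \<longleftrightarrow> g \<in> extremal_set G S"
proof -
  have "g \<in> carrier G" using assms(3) by (simp add: in_extremal_set_iff)
  then show ?thesis
    using extremal_set_add_mset_num_subsums[OF assms] assms(1)
    by (simp add: in_extremal_set_iff) linarith
qed

lemma extremal_set_add_mset_imp:
  assumes "x \<in> carrier G" "seq_over G S" "g \<in> extremal_set G (add_mset x S)"
    and "g \<in> subsums G S" "g \<otimes> inv x \<in> subsums G S"
  shows "g \<in> extremal_set G S"
proof -
  have "g \<in> carrier G" using assms(3) by (simp add: in_extremal_set_iff)
  moreover have "2 ^ Suc (size S) \<le> num_subsums G g S * 2 ^ davenport G"
    "2 ^ Suc (size S) \<le> num_subsums G (g \<otimes> inv x) S * 2 ^ davenport G"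
    using num_subsums_lower_bound[OF assms(2)] assms(4,5) by blast+
  ultimately show ?thesis
    using extremal_set_add_mset_num_subsums[OF assms(1-3)] by (simp add: in_extremal_set_iff)
qed

lemma inv_powers_in_extremal_set_remove1:
  assumes "x \<in> carrier G" "seq_over G S" "ord x \<le> Suc (count S x)"
    and extremal: "\<And>i. i \<le> j \<Longrightarrow> inv x [^] i \<in> extremal_set G (add_mset x S)"
    and "i \<le> Suc j"
  shows "inv x [^] i \<in> extremal_set G S"
  using \<open>i \<le> Suc j\<close>
proof (induction i)
  case 0
  have "inv x \<in> subsums G S" using assms(1,3) ord_pos by (intro inv_in_subsums)
  then show ?case
    using extremal[of 0] assms(1) by (intro extremal_set_add_mset_imp[OF assms(1,2)]) simp_all
next
  case (Suc i)
  then show ?case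
    using extremal_set_add_mset_shift_iff[OF assms(1,2) extremal[of i]] by simp
qed

lemma inv_powers_in_extremal_set_Diff:
  assumes "x \<in> carrier G" "seq_over G S" "\<one> \<in> extremal_set G S"
    and "ord x + j \<le> Suc (count S x)" "i \<le> j"
  shows "inv x [^] i \<in> extremal_set G (S - replicate_mset j x)"
  using assms(4,5)
proof (induction j arbitrary: i)
  case 0
  then show ?case using assms(3) by simp
next
  case (Suc j)
  define U where "U = S - replicate_mset (Suc j) x"
  have U: "seq_over G U" unfolding U_def using assms(2) by (rule seq_over_subseteq) simp
  have S_eq: "S - replicate_mset j x = add_mset x U"
    unfolding U_def using ord_pos[OF assms(1)] Suc.prems(1) by (intro multiset_eqI) auto
  show ?case
    unfolding U_def[symmetric]
  proof (rule inv_powers_in_extremal_set_remove1[OF assms(1) U _ _ Suc.prems(2)])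
    show "ord x \<le> Suc (count U x)" using Suc.prems(1) by (simp add: U_def)
    show "inv x [^] i \<in> extremal_set G (add_mset x U)" if "i \<le> j" for i
      using Suc.IH[of i] Suc.prems(1) that S_eq by simp
  qed
qed

lemma generate_inv_subset_extremal_set:
  assumes "x \<in> carrier G" "seq_over G S" "\<one> \<in> extremal_set G S" "2 * ord x \<le> count S x"
  shows "generate G {inv x} \<subseteq> extremal_set G (S - replicate_mset (ord x) x)"
proof
  fix y assume "y \<in> generate G {inv x}"
  then obtain k :: nat where "y = inv x [^] k"
    using generate_pow_on_finite_carrier[OF finite_carrier, of "inv x"] assms(1) by auto
  then obtain i where "i \<in> {0..ord x - 1}" "y = inv x [^] i"
    using ord_elems[OF finite_carrier, of "inv x"] assms(1) by auto
  then show "y \<in> extremal_set G (S - replicate_mset (ord x) x)"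
    using inv_powers_in_extremal_set_Diff[OF assms(1-3)] assms(4) by auto
qed

lemma subgroup_subset_extremal_set_imp:
  assumes "subgroup H G" "seq_over G S" "H \<subseteq> extremal_set G S"
  shows "2 ^ davenport G \<le> card H * 2 ^ davenport (G Mod H)"
proof -
  interpret Q: finite_comm_group "G Mod H" using assms(1) by (rule finite_comm_group_FactGroup)
  interpret proj: comm_group_hom G "G Mod H" "\<lambda>x. H #> x"
    using assms(1) by (rule comm_group_hom_FactGroup)
  let ?S' = "image_mset (\<lambda>x. H #> x) S"
  let ?N = "num_subsums (G Mod H) \<one>\<^bsub>G Mod H\<^esub> ?S'"
  have "?N * 2 ^ davenport G = (\<Sum>h\<in>H. num_subsums G h S * 2 ^ davenport G)"
    using num_subsums_FactGroup_one[OF finite_carrier assms(1,2)] by (simp add: sum_distrib_right)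
  also have "\<dots> = (\<Sum>h\<in>H. 2 ^ Suc (size S))"
    using assms(3) by (intro sum.cong) (auto simp: in_extremal_set_iff)
  finally have N: "?N * 2 ^ davenport G = card H * 2 ^ Suc (size S)" by simp
  have "2 ^ Suc (size S) \<le> ?N * 2 ^ davenport (G Mod H)"
    using Q.num_subsums_lower_bound[OF proj.seq_over_image[OF assms(2)] Q.one_in_subsums] by simp
  then have "2 ^ Suc (size S) * 2 ^ davenport G
      \<le> ?N * 2 ^ davenport (G Mod H) * 2 ^ davenport G" by (rule mult_le_mono1)
  also have "\<dots> = 2 ^ Suc (size S) * (card H * 2 ^ davenport (G Mod H))"
    using N by (simp add: mult.commute mult.left_commute)
  finally show ?thesis by simp
qed

lemma generate_subset_extremal_set_imp:
  assumes "h \<in> carrier G" "h \<noteq> \<one>" "seq_over G S" "generate G {h} \<subseteq> extremal_set G S"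
  shows "ord h = 2" "davenport G \<le> Suc (davenport (G Mod generate G {h}))"
proof -
  let ?H = "generate G {h}"
  have H: "subgroup ?H G" using assms(1) by (intro generate_is_subgroup) simp
  have upper: "2 ^ davenport G \<le> ord h * 2 ^ davenport (G Mod ?H)"
    using subgroup_subset_extremal_set_imp[OF H assms(3,4)] generate_pow_card[OF assms(1)] by simp
  have "h \<in> ?H" by (simp add: generate.incl)
  then have "2 ^ (ord h + davenport (G Mod ?H)) \<le> (2::nat) ^ Suc (davenport G)"
    using davenport_FactGroup_add_ord[OF H] by (intro power_increasing) (simp_all add: add.commute)
  then have "2 ^ ord h * 2 ^ davenport (G Mod ?H) \<le> (2::nat) * 2 ^ davenport G"
    by (simp add: power_add)
  also have "\<dots> \<le> 2 * (ord h * 2 ^ davenport (G Mod ?H))" using upper by simp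
  finally have "2 ^ ord h \<le> 2 * ord h" by simp
  moreover have "2 * m < 2 ^ m" if "3 \<le> m" for m :: nat
    using that by (induction m rule: nat_induct_at_least) auto
  ultimately have "\<not> 3 \<le> ord h" by (meson not_less)
  moreover have "ord h \<noteq> 1" "0 < ord h" using assms(1,2) ord_eq_1 ord_pos by blast+
  ultimately show "ord h = 2" by linarith
  then have "(2::nat) ^ davenport G \<le> 2 ^ Suc (davenport (G Mod ?H))" using upper by simp
  then show "davenport G \<le> Suc (davenport (G Mod ?H))" by (simp only: power_increasing_iff)
qed

end

lemma (in finite_comm_group) long_extremal_seqE:
  assumes "subgroup H G" "card H = 2" "davenport G \<le> Suc (davenport (G Mod H))"
  obtains S where "seq_over G S" "\<one> \<notin># S" "attains_bound G \<one> S" "t < size S"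
proof -
  interpret Q: finite_comm_group "G Mod H" using assms(1) by (rule finite_comm_group_FactGroup)
  interpret proj: comm_group_hom G "G Mod H" "\<lambda>x. H #> x"
    using assms(1) by (rule comm_group_hom_FactGroup)
  obtain h where h: "h \<in> carrier G" "h \<noteq> \<one>" "H = {\<one>, h}" "h \<otimes> h = \<one>"
    using subgroup_card_twoE[OF assms(1,2)] .
  obtain S' where S': "seq_over (G Mod H) S'" "zero_sum_free (G Mod H) S'"
    "Suc (size S') = davenport (G Mod H)"
    by (rule Q.longest_zero_sum_freeE)
  obtain S where S: "seq_over G S" "image_mset (\<lambda>x. H #> x) S = S'"
    using proj.seq_preimageE[OF _ S'(1)] by (auto simp: carrier_FactGroup)
  let ?T = "replicate_mset (Suc t) h + S"
  have "zero_sum_free G S"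
    using proj.zero_sum_free_union_kernel[of S "{#}"] S S'(2) by simp
  then have "\<one> \<notin># ?T" using h(2) zero_sum_free_one_notin by auto
  have "ord h \<noteq> 1" "0 < ord h" using h(1,2) ord_eq_1 ord_pos by blast+
  then have "Suc (davenport (G Mod H)) \<le> davenport G"
    using davenport_FactGroup_add_ord[OF assms(1), of h] h(3) by simp
  then have davenport_eq: "davenport G = Suc (Suc (size S))"
    using assms(3) S'(3) S(2) by auto
  have "num_subsums G \<one> S + num_subsums G h S = 1"
    using num_subsums_FactGroup_one[OF finite_carrier assms(1) S(1)]
      Q.num_subsums_one_eq_1_iff[OF S'(1)] S(2) S'(2) h(2,3) by simp
  then have "num_subsums G \<one> ?T = 2 ^ t"
    using num_subsums_replicate_mset_involution[OF h(1,4) S(1) one_closed] h(1) by simp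
  then have "attains_bound G \<one> ?T"
    by (simp add: attains_bound_iff davenport_eq power_add)
  moreover have "seq_over G ?T" using S(1) h(1) by (simp add: seq_over_replicate_mset)
  moreover have "t < size ?T" by simp
  ultimately show thesis using that \<open>\<one> \<notin># ?T\<close> by blast
qed

section \<open>The implications\<close>

lemma (in comm_group) minimal_zero_sum_size_ge_2:
  assumes "minimal_zero_sum G T" "\<one> \<notin># T"
  shows "2 \<le> size T"
proof (rule ccontr)
  assume "\<not> 2 \<le> size T"
  moreover have T: "seq_over G T" "T \<noteq> {#}" "seq_sum G T = \<one>"
    using assms(1) by (auto simp: minimal_zero_sum_def)
  ultimately have "size T = 1" by (simp add: not_le less_2_cases_iff)
  then obtain x where "T = {#x#}" by (metis size_1_singleton_mset)
  then show False using T assms(2) by simp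
qed

context finite_comm_group
begin

lemma extremal_seqs_disjoint_imp_bounded:
  assumes "extremal_seqs_disjoint G"
  shows "extremal_seqs_bounded G"
  unfolding extremal_seqs_bounded_def
proof (intro exI allI impI, elim conjE)
  fix S assume S: "seq_over G S" "\<one> \<notin># S" "attains_bound G \<one> S"
  define A where "A = {T. T \<subseteq># S \<and> minimal_zero_sum G T}"
  have card: "int (card A) = int (size S) - int (davenport G) + 1"
    and disjoint: "\<And>T U. T \<in> A \<Longrightarrow> U \<in> A \<Longrightarrow> T \<noteq> U \<Longrightarrow> T \<inter># U = {#}"
    using assms S unfolding extremal_seqs_disjoint_def A_def by blast+
  have "2 \<le> size T" if "T \<in> A" for T
    using that S(2) by (intro minimal_zero_sum_size_ge_2) (auto simp: A_def dest: mset_subset_eqD)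
  then have "2 * card A \<le> (\<Sum>T\<in>A. size T)"
    using sum_mono[of A "\<lambda>_. 2" size] by simp
  also have "\<dots> = size (\<Sum>A)" by simp
  also have "\<dots> \<le> size S"
    using disjoint by (intro size_mset_mono sum_disjoint_mset_subseteq) (auto simp: A_def)
  finally show "size S \<le> 2 * davenport G" using card by linarith
qed

lemma extremal_seqs_bounded_imp_quotient_gap:
  assumes "extremal_seqs_bounded G"
  shows "davenport_quotient_gap G"
  unfolding davenport_quotient_gap_def
proof (intro allI impI, elim conjE)
  fix H assume H: "subgroup H G" and iso: "G\<lparr>carrier := H\<rparr> \<cong> integer_mod_group 2"
  have card: "card H = 2" using iso_same_card[OF iso] by (simp add: carrier_integer_mod_group)
  obtain t where t: "\<And>S. seq_over G S \<Longrightarrow> \<one> \<notin># S \<Longrightarrow> attains_bound G \<one> S \<Longrightarrow> size S \<le> t"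
    using assms unfolding extremal_seqs_bounded_def by blast
  show "davenport (G Mod H) + 2 \<le> davenport G"
  proof (rule ccontr)
    assume "\<not> ?thesis"
    then have "davenport G \<le> Suc (davenport (G Mod H))" by simp
    then obtain S where "seq_over G S" "\<one> \<notin># S" "attains_bound G \<one> S" "t < size S"
      by (rule long_extremal_seqE[OF H card])
    then show False using t[of S] by simp
  qed
qed

lemma quotient_gap_imp_extremal_sets_no_subgroup:
  assumes "davenport_quotient_gap G"
  shows "extremal_sets_no_subgroup G"
  unfolding extremal_sets_no_subgroup_def
proof (intro allI impI notI, elim conjE exE)
  fix S K assume S: "seq_over G S" and K: "subgroup K G" "K \<noteq> {\<one>}" "K \<subseteq> extremal_set G S"
  obtain h where h: "h \<in> K" "h \<noteq> \<one>" using K(2) subgroup.one_closed[OF K(1)] by blast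
  have h_carrier: "h \<in> carrier G" using K(1) h(1) by (rule subgroup.mem_carrier)
  have "generate G {h} \<subseteq> K" using h(1) K(1) by (intro generate_subgroup_incl) auto
  then have "generate G {h} \<subseteq> extremal_set G S" using K(3) by blast
  note order_two_and_no_gap = generate_subset_extremal_set_imp[OF h_carrier h(2) S this]
  have "subgroup (generate G {h}) G" using h_carrier by (intro generate_is_subgroup) simp
  moreover have "G\<lparr>carrier := generate G {h}\<rparr> \<cong> integer_mod_group 2"
    using generate_iso_integer_mod_group[OF h_carrier] order_two_and_no_gap(1) by simp
  ultimately have "davenport (G Mod generate G {h}) + 2 \<le> davenport G"
    using assms unfolding davenport_quotient_gap_def by blast
  then show False using order_two_and_no_gap(2) by simp
qed

lemma extremal_sets_no_subgroup_imp_bounded: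
  assumes "extremal_sets_no_subgroup G"
  shows "extremal_seqs_bounded G"
  unfolding extremal_seqs_bounded_def
proof (intro exI allI impI, elim conjE)
  fix S assume S: "seq_over G S" "\<one> \<notin># S" "attains_bound G \<one> S"
  show "size S \<le> order G * (2 * order G + davenport G)"
  proof (rule ccontr)
    assume "\<not> ?thesis"
    then have "card (carrier G) * (2 * order G + davenport G) < size S"
      unfolding order_def by (rule not_le_imp_less)
    then obtain x where x: "x \<in># S" "2 * order G + davenport G < count S x"
      using ex_count_greater[OF finite_carrier S(1)[unfolded seq_over_def]] by blast
    have x_nontrivial: "x \<in> carrier G" "x \<noteq> \<one>" using x(1) S(1,2) by (auto simp: seq_over_def)
    have "ord x \<le> order G" using ord_le_group_order[OF finite_carrier x_nontrivial(1)] .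
    define V where "V = S - replicate_mset (ord x) x"
    define H where "H = generate G {inv x}"
    have "seq_over G V" unfolding V_def using S(1) by (rule seq_over_subseteq) simp
    moreover have "davenport G - 1 \<le> size V"
      using count_le_size[of V x] \<open>ord x \<le> order G\<close> x(2) by (simp add: V_def)
    moreover have "subgroup H G"
      unfolding H_def using x_nontrivial(1) by (intro generate_is_subgroup) simp
    moreover have "inv x \<in> H" unfolding H_def by (rule generate.incl) simp
    then have "H \<noteq> {\<one>}" using x_nontrivial by auto
    moreover have "H \<subseteq> extremal_set G V"
      unfolding V_def H_def using \<open>ord x \<le> order G\<close> x(2) S(3)
      by (intro generate_inv_subset_extremal_set[OF x_nontrivial(1) S(1)])
        (simp_all add: extremal_set_def)
    ultimately show False using assms unfolding extremal_sets_no_subgroup_def by blast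
  qed
qed

end

theorem theorem3p7:
  fixes G :: "('a, 'b) monoid_scheme" and r :: nat and n :: "nat \<Rightarrow> nat"
  assumes "comm_group G" and "finite (carrier G)"
    and "\<forall>i\<in>{1..r}. 0 < n i"
    and "\<forall>i\<in>{1..<r}. n i dvd n (i + 1)"
    and "G \<cong> product_group {1..r} (\<lambda>i. integer_mod_group (n i))"
  shows "(extremal_seqs_disjoint G \<longrightarrow> extremal_seqs_bounded G) \<and>
    (extremal_seqs_bounded G \<longleftrightarrow> davenport_quotient_gap G) \<and>
    (davenport_quotient_gap G \<longleftrightarrow> extremal_sets_no_subgroup G)"
proof -
  interpret finite_comm_group G
    using assms(1,2) by (simp add: finite_comm_group_def finite_comm_group_axioms_def)
  show ?thesis
    using extremal_seqs_disjoint_imp_bounded extremal_seqs_bounded_imp_quotient_gap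
      quotient_gap_imp_extremal_sets_no_subgroup extremal_sets_no_subgroup_imp_bounded
    by blast
qed

end
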